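(* For real numbers $\lambda,c$ with $0<|c|<\lambda$ let $\gamma(\lambda,c)$ denote the logarithmic decrement of the system $$u''+u'+\lambda u+cv=0,\qquad v''+\lambda v+cu=0.$$ Then: (i) $\gamma(\lambda,c)<\frac14$ for all real $\lambda,c$ with $0<|c|<\lambda$; (ii) there exists $\varepsilon_0>0$ such that for every $\varepsilon\in(0,\varepsilon_0)$ there exist $\lambda>0$ and $c\in(0,\lambda)$ with $\gamma(\lambda,c)=\frac14-\varepsilon$.
   Context: Let $T(t)$, $t\ge0$, be the linear semigroup on $\mathbb{R}^4$ mapping initial data $(u(0),v(0),u'(0),v'(0))$ to $(u(t),v(t),u'(t),v'(t))$, where $(u,v)$ is the corresponding solution of the system. The logarithmic decrement $\gamma(\lambda,c)$ is the supremum of the set of $\gamma>0$ for which $e^{\gamma t}\|T(t)\|$ is bounded for $t\ge0$. *)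

theory Defs
  imports "HOL-Analysis.Analysis"
begin

text \<open>
  Solutions on the half-line of u'' + u' + lam u + c v = 0, v'' + lam v + c u = 0. The
  functions \<open>u1\<close>, \<open>v1\<close> are u', v', and \<open>u2\<close>, \<open>v2\<close> are the values of u'', v'' at time \<open>t\<close>;
  at \<open>t = 0\<close> all derivatives are one-sided.
\<close>

definition solution ::
  "real \<Rightarrow> real \<Rightarrow> (real \<Rightarrow> real) \<Rightarrow> (real \<Rightarrow> real) \<Rightarrow> (real \<Rightarrow> real) \<Rightarrow> (real \<Rightarrow> real) \<Rightarrow> bool"
where
  "solution lam c u v u1 v1 \<longleftrightarrow>
     (\<forall>t\<ge>0.
        (u has_real_derivative u1 t) (at t within {0..}) \<and>
        (v has_real_derivative v1 t) (at t within {0..}) \<and>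
        (\<exists>u2 v2.
           (u1 has_real_derivative u2) (at t within {0..}) \<and>
           (v1 has_real_derivative v2) (at t within {0..}) \<and>
           u2 + u1 t + lam * u t + c * v t = 0 \<and>
           v2 + lam * v t + c * u t = 0))"

definition semigroup_T :: "real \<Rightarrow> real \<Rightarrow> real \<Rightarrow> real^4 \<Rightarrow> real^4" where
  "semigroup_T lam c t x =
     (THE y. \<exists>u v u1 v1. solution lam c u v u1 v1 \<and>
        vector [u 0, v 0, u1 0, v1 0] = x \<and>
        y = vector [u t, v t, u1 t, v1 t])"

text \<open>
  \<open>onorm\<close> is the operator norm for the Euclidean norm on \<open>real^4\<close>. The supremum is taken in the
  reals, so it is meaningful only if the set is nonempty and bounded above; this is the case
  whenever 0 < |c| < lam, as the system is then exponentially stable and its characteristic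
  roots have sum -1.
\<close>

definition log_decrement :: "real \<Rightarrow> real \<Rightarrow> real" where
  "log_decrement lam c =
     Sup {g. g > 0 \<and> bounded ((\<lambda>t. exp (g * t) * onorm (semigroup_T lam c t)) ` {0..})}"

end

theory Submission
  imports Defs "HOL-Computational_Algebra.Fundamental_Theorem_Algebra"
begin

text \<open>
  The logarithmic decrement is minus the largest real part of the roots of the characteristic
  polynomial \<open>(z\<^sup>2 + z + lam) (z\<^sup>2 + lam) - c\<^sup>2\<close>. Its roots have sum \<open>-1\<close>, so the largest real part
  is at least \<open>-1/4\<close>; equality would make all \<open>z + 1/4\<close> imaginary, which the linear
  coefficient of the shifted polynomial excludes. Conversely, one prescribes the factorisation
  of the shifted polynomial into two quadratics and reads off \<open>lam\<close> and \<open>c\<close>.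

  For the growth bound, and for existence of solutions, no Jordan form is needed: with
  \<open>(A - z\<^sub>1) \<dots> (A - z\<^sub>4) = 0\<close> by Cayley-Hamilton, \<open>x' = A x\<close> reduces successively to forced scalar
  equations \<open>x' = z x + y\<close>, where \<open>y\<close> solves \<open>y' = A y\<close> with initial value \<open>(A - z) x(0)\<close>.
\<close>

section \<open>Linear differential equations with exponential bounds\<close>

lemma has_vector_derivative_exp_of_real:
  "((\<lambda>t. exp (z * of_real t)) has_vector_derivative z * exp (z * of_real t)) (at t within S)"
  for z :: complex
proof -
  have "((\<lambda>w. exp (z * w)) has_field_derivative z * exp (z * of_real t)) (at (of_real t))"
    by (auto intro!: derivative_eq_intros)
  then show ?thesis
    by (rule has_vector_derivative_real_field)
qed

lemma linear_ode_scalar_zero: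
  fixes w :: "real \<Rightarrow> complex"
  assumes w: "\<And>t. (w has_vector_derivative z * w t) (at t)" and w0: "w 0 = 0"
  shows "w t = 0"
proof -
  have "((\<lambda>t. exp (- z * of_real t) * w t) has_vector_derivative 0) (at t within UNIV)" for t
    using has_vector_derivative_mult[OF has_vector_derivative_exp_of_real[of "- z"] w]
    by (simp add: algebra_simps)
  then obtain k where k: "\<And>t. exp (- z * of_real t) * w t = k"
    using has_vector_derivative_zero_constant[of UNIV "\<lambda>t. exp (- z * of_real t) * w t"] by auto
  have "k = 0" using k[of 0] w0 by simp
  with k[of t] show ?thesis by simp
qed

text \<open>Variation of constants. Because \<open>Re z < a\<close> is strict, the integral of
  \<open>exp ((a - Re z) * s)\<close> is dominated by a multiple of its integrand at the endpoint,
  so the forcing rate \<open>a\<close> is inherited by \<open>x\<close> without a polynomial factor,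
  even when roots repeat.\<close>

lemma scalar_ode_forced:
  fixes y :: "real \<Rightarrow> complex"
  assumes cont: "\<And>t. isCont y t"
    and bound: "\<And>t. t \<ge> 0 \<Longrightarrow> norm (y t) \<le> C * exp (a * t)" and z: "Re z < a"
  shows "\<exists>x D. x 0 = x0 \<and> (\<forall>t. (x has_vector_derivative z * x t + y t) (at t)) \<and>
    (\<forall>t\<ge>0. norm (x t) \<le> D * exp (a * t))"
proof -
  have "\<exists>F. \<forall>t::real. -\<infinity> < ereal t \<longrightarrow> ereal t < \<infinity> \<longrightarrow>
      (F has_vector_derivative exp (- z * of_real t) * y t) (at t)"
    by (rule einterval_antiderivative) (auto intro!: continuous_intros cont)
  then obtain F where F: "\<And>t. (F has_vector_derivative exp (- z * of_real t) * y t) (at t)"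
    by auto
  define x where "x t = exp (z * of_real t) * (x0 + (F t - F 0))" for t
  \<comment> \<open>An antiderivative of \<open>C * exp ((a - Re z) * t)\<close>, which majorises
    the norm of the derivative of \<open>F\<close> on the half-line.\<close>
  define \<phi> where "\<phi> t = C / (a - Re z) * exp ((a - Re z) * t)" for t
  have C: "C \<ge> 0" using order_trans[OF norm_ge_zero bound[of 0]] by simp
  have F_bound: "norm (F t - F 0) \<le> \<phi> t" if "t \<ge> 0" for t
  proof (cases "t = 0")
    case True
    then show ?thesis using z C by (simp add: \<phi>_def)
  next
    case False
    have "norm (F t - F 0) \<le> \<phi> t - \<phi> 0"
    proof (rule differentiable_bound_general)
      show "0 < t" using that False by simp
      show "continuous_on {0..t} F"
        by (rule continuous_on_vector_derivative) (rule has_vector_derivative_at_within[OF F])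
      show "continuous_on {0..t} \<phi>"
        unfolding \<phi>_def by (intro continuous_intros)
      show "(F has_vector_derivative exp (- z * of_real s) * y s) (at s)" for s :: real
        by (rule F)
      show "(\<phi> has_vector_derivative C * exp ((a - Re z) * s)) (at s)" for s :: real
        unfolding \<phi>_def has_real_derivative_iff_has_vector_derivative[symmetric]
        using z by (auto intro!: derivative_eq_intros)
      fix s :: real assume "0 < s"
      have "norm (exp (- z * of_real s) * y s) \<le> exp (- Re z * s) * (C * exp (a * s))"
        using bound[of s] \<open>0 < s\<close> by (simp add: norm_mult mult_left_mono)
      also have "\<dots> = C * exp ((a - Re z) * s)"
        by (simp add: algebra_simps flip: exp_add)
      finally show "norm (exp (- z * of_real s) * y s) \<le> C * exp ((a - Re z) * s)" .
    qed
    moreover have "\<phi> 0 \<ge> 0" using C z by (simp add: \<phi>_def)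
    ultimately show ?thesis by simp
  qed
  show ?thesis
  proof (intro exI conjI allI impI)
    show "x 0 = x0" by (simp add: x_def)
    show "(x has_vector_derivative z * x t + y t) (at t)" for t
    proof -
      have G: "((\<lambda>t. x0 + (F t - F 0)) has_vector_derivative exp (- z * of_real t) * y t) (at t)"
        by (auto intro!: derivative_eq_intros F)
      have "exp (z * of_real t) * (exp (- z * of_real t) * y t) = y t"
        by (simp add: exp_minus)
      then show ?thesis
        unfolding x_def
        by (intro has_vector_derivative_eq_rhs
            [OF has_vector_derivative_mult[OF has_vector_derivative_exp_of_real G]])
          (simp add: algebra_simps)
    qed
    fix t :: real assume t: "t \<ge> 0"
    have "norm (x t) \<le> exp (Re z * t) * (norm x0 + \<phi> t)"
      unfolding x_def norm_mult using F_bound[OF t]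
      by (intro mult_mono) (auto intro: norm_triangle_le)
    also have "\<dots> = norm x0 * exp (Re z * t) + C / (a - Re z) * exp (a * t)"
      by (simp add: \<phi>_def algebra_simps flip: exp_add)
    also have "\<dots> \<le> norm x0 * exp (a * t) + C / (a - Re z) * exp (a * t)"
      using z t by (auto intro!: mult_left_mono mult_right_mono)
    finally show "norm (x t) \<le> (norm x0 + C / (a - Re z)) * exp (a * t)"
      by (simp add: algebra_simps)
  qed
qed

text \<open>Induction on the list: each factor \<open>A - z\<close> peeled off costs one forced
  scalar equation per coordinate. The empty list leaves \<open>x0 = 0\<close> and the zero
  solution.\<close>

lemma linear_ode_decay:
  fixes A :: "complex^'n^'n"
  assumes "\<forall>z\<in>set zs. Re z < a"
    and "fold (\<lambda>z x. A *v x - z *s x) zs x0 = 0"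
  shows "\<exists>x C. x 0 = x0 \<and>
    (\<forall>t i. ((\<lambda>t. x t $ i) has_vector_derivative (A *v x t) $ i) (at t)) \<and>
    (\<forall>t\<ge>0. \<forall>i. norm (x t $ i) \<le> C * exp (a * t))"
  using assms
proof (induction zs arbitrary: x0)
  case Nil
  then show ?case
    by (intro exI[of _ "\<lambda>_. 0"] exI[of _ 0]) auto
next
  case (Cons z zs)
  have "\<exists>y C. y 0 = A *v x0 - z *s x0 \<and>
      (\<forall>t i. ((\<lambda>t. y t $ i) has_vector_derivative (A *v y t) $ i) (at t)) \<and>
      (\<forall>t\<ge>0. \<forall>i. norm (y t $ i) \<le> C * exp (a * t))"
    using Cons.prems by (intro Cons.IH) auto
  then obtain y C where y0: "y 0 = A *v x0 - z *s x0"
    and y: "\<forall>t i. ((\<lambda>t. y t $ i) has_vector_derivative (A *v y t) $ i) (at t)"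
      "\<forall>t\<ge>0. \<forall>i. norm (y t $ i) \<le> C * exp (a * t)"
    by blast
  note y' = y(1)[rule_format] and yb = y(2)[rule_format]
  have "\<exists>x D. x 0 = x0 $ i \<and> (\<forall>t. (x has_vector_derivative z * x t + y t $ i) (at t)) \<and>
     (\<forall>t\<ge>0. norm (x t) \<le> D * exp (a * t))" for i
  proof -
    have "Re z < a" using Cons.prems(1) by simp
    with has_vector_derivative_continuous[OF y'] yb show ?thesis
      by (intro scalar_ode_forced) blast+
  qed
  then obtain \<xi> D where \<xi>0: "\<And>i. \<xi> i 0 = x0 $ i"
    and \<xi>': "\<And>i t. (\<xi> i has_vector_derivative z * \<xi> i t + y t $ i) (at t)"
    and \<xi>b: "\<And>i t. t \<ge> 0 \<Longrightarrow> norm (\<xi> i t) \<le> D i * exp (a * t)"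
    by metis
  define x where "x t = (\<chi> i. \<xi> i t)" for t
  have x0: "x 0 = x0" by (simp add: x_def \<xi>0 vec_eq_iff)
  have x': "((\<lambda>t. x t $ i) has_vector_derivative (z *s x t + y t) $ i) (at t)" for i t
    using \<xi>'[of i t] by (simp add: x_def)
  have A': "((\<lambda>t. (A *v u t) $ i) has_vector_derivative (A *v u' t) $ i) (at t)"
    if "\<And>i. ((\<lambda>t. u t $ i) has_vector_derivative u' t $ i) (at t)" for u u' i t
    unfolding matrix_vector_mult_def vec_lambda_beta
    by (intro has_vector_derivative_sum has_vector_derivative_mult_right that)
  \<comment> \<open>The defect \<open>A x - z x - y\<close> solves \<open>w' = z w\<close> and vanishes at \<open>0\<close>.\<close>
  have w: "(A *v x t - z *s x t - y t) $ i = 0" for t i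
  proof (rule linear_ode_scalar_zero)
    show "(A *v x 0 - z *s x 0 - y 0) $ i = 0" by (simp add: x0 y0)
    fix t
    have "((\<lambda>t. (A *v x t) $ i - z * x t $ i - y t $ i) has_vector_derivative
        (A *v (z *s x t + y t)) $ i - z * (z *s x t + y t) $ i - (A *v y t) $ i) (at t)"
      by (intro has_vector_derivative_diff has_vector_derivative_mult_right
          A'[where u' = "\<lambda>t. z *s x t + y t"] x' y')
    moreover have "(A *v (z *s x t + y t)) $ i - z * (z *s x t + y t) $ i - (A *v y t) $ i
        = z * (A *v x t - z *s x t - y t) $ i"
      by (simp add: matrix_vector_right_distrib vector_scalar_commute right_diff_distrib distrib_left)
    ultimately show "((\<lambda>t. (A *v x t - z *s x t - y t) $ i) has_vector_derivative
        z * (A *v x t - z *s x t - y t) $ i) (at t)"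
      by simp
  qed
  have "((\<lambda>t. x t $ i) has_vector_derivative (A *v x t) $ i) (at t)" for i t
  proof -
    have "(z *s x t + y t) $ i = (A *v x t) $ i" using w[of t i] by (simp add: algebra_simps)
    with x'[where i=i and t=t] show ?thesis by metis
  qed
  moreover have "norm (x t $ i) \<le> Max (range D) * exp (a * t)" if "t \<ge> 0" for t i
  proof -
    \<comment> \<open>The scalar lemma gives one constant per coordinate; the finite index type
      allows taking the largest.\<close>
    have "D i * exp (a * t) \<le> Max (range D) * exp (a * t)"
      by (intro mult_right_mono Max_ge) auto
    with \<xi>b[OF that, of i] show ?thesis unfolding x_def vec_lambda_beta by linarith
  qed
  ultimately show ?case using x0 by blast
qed

section \<open>Superposition, uniqueness and the value of the semigroup\<close>

lemma vector_4 [simp]: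
  "(vector [a, b, c, d] :: 'a::zero^4) $ 1 = a"
  "(vector [a, b, c, d] :: 'a::zero^4) $ 2 = b"
  "(vector [a, b, c, d] :: 'a::zero^4) $ 3 = c"
  "(vector [a, b, c, d] :: 'a::zero^4) $ 4 = d"
  unfolding vector_def by simp_all

lemma vector_4_eta: "vector [x $ 1, x $ 2, x $ 3, x $ 4] = (x :: 'a::zero^4)"
  by (simp add: vec_eq_iff forall_4)

lemma vector_4_eq_iff:
  "(vector [a, b, c, d] :: 'a::zero^4) = vector [a', b', c', d'] \<longleftrightarrow>
    a = a' \<and> b = b' \<and> c = c' \<and> d = d'"
  by (auto simp: vec_eq_iff forall_4)

lemma solution_linear_combination:
  assumes "solution lam c u v u1 v1" "solution lam c u' v' u1' v1'"
  shows "solution lam c (\<lambda>t. \<alpha> * u t + \<beta> * u' t) (\<lambda>t. \<alpha> * v t + \<beta> * v' t)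
    (\<lambda>t. \<alpha> * u1 t + \<beta> * u1' t) (\<lambda>t. \<alpha> * v1 t + \<beta> * v1' t)"
  unfolding solution_def
proof (intro allI impI)
  fix t :: real assume "t \<ge> 0"
  with assms(1) obtain u2 v2 where 1:
      "(u has_real_derivative u1 t) (at t within {0..})"
      "(v has_real_derivative v1 t) (at t within {0..})"
      "(u1 has_real_derivative u2) (at t within {0..})"
      "(v1 has_real_derivative v2) (at t within {0..})"
    and e1: "u2 + u1 t + lam * u t + c * v t = 0" "v2 + lam * v t + c * u t = 0"
    unfolding solution_def by blast
  from assms(2) \<open>t \<ge> 0\<close> obtain u2' v2' where 2:
      "(u' has_real_derivative u1' t) (at t within {0..})"
      "(v' has_real_derivative v1' t) (at t within {0..})"
      "(u1' has_real_derivative u2') (at t within {0..})"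
      "(v1' has_real_derivative v2') (at t within {0..})"
    and e2: "u2' + u1' t + lam * u' t + c * v' t = 0" "v2' + lam * v' t + c * u' t = 0"
    unfolding solution_def by blast
  have comb: "((\<lambda>t. \<alpha> * f t + \<beta> * g t) has_real_derivative \<alpha> * f' + \<beta> * g') (at t within {0..})"
    if "(f has_real_derivative f') (at t within {0..})"
      "(g has_real_derivative g') (at t within {0..})" for f g f' g'
    by (intro DERIV_add DERIV_cmult that)
  have "\<alpha> * (u2 + u1 t + lam * u t + c * v t) + \<beta> * (u2' + u1' t + lam * u' t + c * v' t) = 0"
    and "\<alpha> * (v2 + lam * v t + c * u t) + \<beta> * (v2' + lam * v' t + c * u' t) = 0"
    by (simp_all only: e1 e2)
  then have "\<alpha> * u2 + \<beta> * u2' + (\<alpha> * u1 t + \<beta> * u1' t) + lam * (\<alpha> * u t + \<beta> * u' t)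
        + c * (\<alpha> * v t + \<beta> * v' t) = 0"
    and "\<alpha> * v2 + \<beta> * v2' + lam * (\<alpha> * v t + \<beta> * v' t) + c * (\<alpha> * u t + \<beta> * u' t) = 0"
    by (simp_all add: algebra_simps)
  with comb[OF 1(1) 2(1)] comb[OF 1(2) 2(2)] comb[OF 1(3) 2(3)] comb[OF 1(4) 2(4)]
  show "((\<lambda>t. \<alpha> * u t + \<beta> * u' t) has_real_derivative \<alpha> * u1 t + \<beta> * u1' t) (at t within {0..}) \<and>
      ((\<lambda>t. \<alpha> * v t + \<beta> * v' t) has_real_derivative \<alpha> * v1 t + \<beta> * v1' t) (at t within {0..}) \<and>
      (\<exists>u2 v2.
        ((\<lambda>t. \<alpha> * u1 t + \<beta> * u1' t) has_real_derivative u2) (at t within {0..}) \<and>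
        ((\<lambda>t. \<alpha> * v1 t + \<beta> * v1' t) has_real_derivative v2) (at t within {0..}) \<and>
        u2 + (\<alpha> * u1 t + \<beta> * u1' t) + lam * (\<alpha> * u t + \<beta> * u' t) + c * (\<alpha> * v t + \<beta> * v' t) = 0 \<and>
        v2 + lam * (\<alpha> * v t + \<beta> * v' t) + c * (\<alpha> * u t + \<beta> * u' t) = 0)"
    by blast
qed

text \<open>Since \<open>\<bar>2 * u * v\<bar> \<le> u\<^sup>2 + v\<^sup>2\<close>, the form is at
  least \<open>(lam - \<bar>c\<bar>) * (u\<^sup>2 + v\<^sup>2)\<close>. It serves both uniqueness of
  solutions and the sign of the characteristic roots.\<close>

lemma energy_coercive:
  fixes c lam u v :: real
  assumes "\<bar>c\<bar> < lam" and "lam * u\<^sup>2 + lam * v\<^sup>2 + 2 * c * u * v \<le> 0"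
  shows "u = 0" "v = 0"
proof -
  have "\<bar>2 * u * v\<bar> \<le> u\<^sup>2 + v\<^sup>2"
    using sum_squares_bound[of "\<bar>u\<bar>" "\<bar>v\<bar>"] by (simp add: abs_mult)
  then have "\<bar>c\<bar> * \<bar>2 * u * v\<bar> \<le> \<bar>c\<bar> * (u\<^sup>2 + v\<^sup>2)"
    by (rule mult_left_mono) simp
  moreover have "\<bar>c\<bar> * \<bar>2 * u * v\<bar> = \<bar>2 * c * u * v\<bar>" by (simp add: abs_mult)
  ultimately have "(lam - \<bar>c\<bar>) * (u\<^sup>2 + v\<^sup>2) \<le> 0"
    using assms(2) by (simp add: algebra_simps)
  then have "u\<^sup>2 + v\<^sup>2 \<le> 0" using assms(1) by (simp add: mult_le_0_iff)
  then show "u = 0" "v = 0" by (simp_all add: sum_power2_le_zero_iff)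
qed

text \<open>
  The physical energy of a solution has derivative \<open>-2 u1\<^sup>2\<close>, and it is positive definite because
  \<open>\<bar>c\<bar> < lam\<close>.
\<close>

lemma solution_zero:
  assumes sol: "solution lam c u v u1 v1" and c: "\<bar>c\<bar> < lam"
    and init: "u 0 = 0" "v 0 = 0" "u1 0 = 0" "v1 0 = 0" and t: "t \<ge> 0"
  shows "u t = 0 \<and> v t = 0 \<and> u1 t = 0 \<and> v1 t = 0"
proof (cases "t = 0")
  case False
  define E where "E s = (u1 s)\<^sup>2 + (v1 s)\<^sup>2 + (lam * (u s)\<^sup>2 + lam * (v s)\<^sup>2 + 2 * c * u s * v s)" for s
  have E': "(E has_real_derivative - 2 * (u1 s)\<^sup>2) (at s within {0..})" if "s \<ge> 0" for s
  proof -
    from sol that obtain u2 v2 where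
      d: "(u has_real_derivative u1 s) (at s within {0..})"
        "(v has_real_derivative v1 s) (at s within {0..})"
        "(u1 has_real_derivative u2) (at s within {0..})"
        "(v1 has_real_derivative v2) (at s within {0..})"
      and e: "u2 + u1 s + lam * u s + c * v s = 0" "v2 + lam * v s + c * u s = 0"
      unfolding solution_def by blast
    have e': "u2 = - u1 s - lam * u s - c * v s" "v2 = - lam * v s - c * u s"
      using e by linarith+
    show ?thesis
      unfolding E_def
      by (auto intro!: derivative_eq_intros d simp: e' algebra_simps power2_eq_square)
  qed
  have "E t \<le> E 0"
  proof (rule DERIV_nonpos_imp_decreasing_open[of 0 t E])
    show "0 \<le> t" by fact
    show "\<exists>y. DERIV E s :> y \<and> y \<le> 0" if "0 < s" "s < t" for s
    proof -
      \<comment> \<open>The one-sided derivatives become two-sided at interior points; at the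
        endpoints the monotonicity criterion asks only for continuity.\<close>
      have "at s within {0..} = at s"
        using that by (intro at_within_interior) simp
      with E'[of s] that show ?thesis by (intro exI[of _ "- 2 * (u1 s)\<^sup>2"]) simp
    qed
    have "continuous_on {0..} E" by (rule DERIV_continuous_on) (use E' in auto)
    then show "continuous_on {0..t} E" by (rule continuous_on_subset) auto
  qed
  then have le: "(u1 t)\<^sup>2 + (v1 t)\<^sup>2 + (lam * (u t)\<^sup>2 + lam * (v t)\<^sup>2 + 2 * c * u t * v t) \<le> 0"
    by (simp add: E_def init)
  then have "lam * (u t)\<^sup>2 + lam * (v t)\<^sup>2 + 2 * c * u t * v t \<le> 0"
    using zero_le_power2[of "u1 t"] zero_le_power2[of "v1 t"] by linarith
  from energy_coercive[OF c this] have uv: "u t = 0" "v t = 0" .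
  with le have "(u1 t)\<^sup>2 + (v1 t)\<^sup>2 \<le> 0" by simp
  with uv show ?thesis by (simp add: sum_power2_le_zero_iff)
qed (use init in simp)

text \<open>Resolves the definite description: two solutions with the same data differ by a solution
  with zero data, which vanishes by the energy argument.\<close>

lemma semigroup_T_eqI:
  assumes sol: "solution lam c u v u1 v1" and c: "\<bar>c\<bar> < lam" and t: "t \<ge> 0"
  shows "semigroup_T lam c t (vector [u 0, v 0, u1 0, v1 0]) = vector [u t, v t, u1 t, v1 t]"
  unfolding semigroup_T_def
proof (rule the_equality)
  fix y
  assume "\<exists>u' v' u1' v1'. solution lam c u' v' u1' v1' \<and>
    vector [u' 0, v' 0, u1' 0, v1' 0] = (vector [u 0, v 0, u1 0, v1 0] :: real^4) \<and>
    y = vector [u' t, v' t, u1' t, v1' t]"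
  then obtain u' v' u1' v1' where sol': "solution lam c u' v' u1' v1'"
    and init: "u' 0 = u 0" "v' 0 = v 0" "u1' 0 = u1 0" "v1' 0 = v1 0"
    and y: "y = vector [u' t, v' t, u1' t, v1' t]"
    by (auto simp: vector_4_eq_iff)
  show "y = vector [u t, v t, u1 t, v1 t]"
    using solution_zero[OF solution_linear_combination[OF sol sol', of 1 "-1"] c _ _ _ _ t]
    by (simp add: y vector_4_eq_iff init)
qed (use sol in blast)

section \<open>Characteristic roots and existence of solutions with a growth bound\<close>

definition char_root :: "real \<Rightarrow> real \<Rightarrow> complex \<Rightarrow> bool" where
  "char_root lam c z \<longleftrightarrow> (z\<^sup>2 + z + of_real lam) * (z\<^sup>2 + of_real lam) = (of_real c)\<^sup>2"

lemma quartic_splits: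
  fixes a b c d :: complex
  obtains z1 z2 z3 z4 where "z1 + z2 + z3 + z4 = - a"
    "z1 * z2 + z1 * z3 + z1 * z4 + z2 * z3 + z2 * z4 + z3 * z4 = b"
    "z1 * z2 * z3 + z1 * z2 * z4 + z1 * z3 * z4 + z2 * z3 * z4 = - c"
    "z1 * z2 * z3 * z4 = d"
proof -
  let ?p = "[:d, c, b, a, 1:]"
  obtain zs where zs: "mset zs = proots ?p" using ex_mset by blast
  have "degree ?p = 4" by simp
  with zs size_proots_complex[of ?p] have "length zs = 4"
    by (metis size_mset)
  then obtain z1 z2 z3 z4 where "zs = [z1, z2, z3, z4]"
    by (auto simp: numeral_eq_Suc length_Suc_conv)
  with zs have "proots ?p = {#z1, z2, z3, z4#}" by simp
  with complex_poly_decompose_multiset[of ?p]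
  have "[:-z1, 1:] * ([:-z2, 1:] * ([:-z3, 1:] * [:-z4, 1:])) = ?p"
    by simp
  then have h: "z1 * (z2 * (z3 * z4)) = d" "- (z1 * (z2 * z3)) - z1 * (z2 * z4) - z1 * (z3 * z4) - z2 * (z3 * z4) = c"
    "z1 * z2 + z1 * z3 + z1 * z4 + z2 * z3 + z2 * z4 + z3 * z4 = b" "- z1 - z2 - z3 - z4 = a"
    by (simp_all add: algebra_simps)
  show thesis
    by (rule that[of z1 z2 z3 z4]; unfold h[symmetric]; simp add: algebra_simps)
qed

text \<open>The polynomial expands to \<open>z^4 + z^3 + 2 lam z^2 + lam z + lam^2 - c^2\<close>.
  Its roots, with multiplicity, are recorded through Vieta's formulas, the form needed for
  Cayley-Hamilton and for locating the roots.\<close>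

lemma char_roots:
  obtains z1 z2 z3 z4 where
    "\<forall>z. char_root lam c z \<longleftrightarrow> z \<in> {z1, z2, z3, z4}"
    "z1 + z2 + z3 + z4 = - 1"
    "z1 * z2 + z1 * z3 + z1 * z4 + z2 * z3 + z2 * z4 + z3 * z4 = 2 * of_real lam"
    "z1 * z2 * z3 + z1 * z2 * z4 + z1 * z3 * z4 + z2 * z3 * z4 = - of_real lam"
    "z1 * z2 * z3 * z4 = (of_real lam)\<^sup>2 - (of_real c)\<^sup>2"
proof -
  obtain z1 z2 z3 z4 :: complex where e: "z1 + z2 + z3 + z4 = - 1"
    "z1 * z2 + z1 * z3 + z1 * z4 + z2 * z3 + z2 * z4 + z3 * z4 = 2 * of_real lam"
    "z1 * z2 * z3 + z1 * z2 * z4 + z1 * z3 * z4 + z2 * z3 * z4 = - of_real lam"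
    "z1 * z2 * z3 * z4 = (of_real lam)\<^sup>2 - (of_real c)\<^sup>2"
    using quartic_splits[of 1 "2 * of_real lam" "of_real lam" "(of_real lam)\<^sup>2 - (of_real c)\<^sup>2"]
    by metis
  have "(z\<^sup>2 + z + of_real lam) * (z\<^sup>2 + of_real lam) - (of_real c)\<^sup>2
      = (z - z1) * (z - z2) * (z - z3) * (z - z4)" for z
  proof -
    have "(z - z1) * (z - z2) * (z - z3) * (z - z4) = z ^ 4 - (z1 + z2 + z3 + z4) * z ^ 3
        + (z1 * z2 + z1 * z3 + z1 * z4 + z2 * z3 + z2 * z4 + z3 * z4) * z\<^sup>2
        - (z1 * z2 * z3 + z1 * z2 * z4 + z1 * z3 * z4 + z2 * z3 * z4) * z + z1 * z2 * z3 * z4"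
      by algebra
    also have "\<dots> = (z\<^sup>2 + z + of_real lam) * (z\<^sup>2 + of_real lam) - (of_real c)\<^sup>2"
      unfolding e by algebra
    finally show ?thesis by simp
  qed
  then have "char_root lam c z \<longleftrightarrow> z \<in> {z1, z2, z3, z4}" for z
    unfolding char_root_def by (subst right_minus_eq[symmetric]) simp
  with e show thesis by (intro that) auto
qed

text \<open>The first-order system matrix in the order \<open>u, v, u', v'\<close>. Complex entries
  allow shifts by non-real roots.\<close>

definition osc_matrix :: "real \<Rightarrow> real \<Rightarrow> complex^4^4" where
  "osc_matrix lam c = vector [vector [0, 0, 1, 0], vector [0, 0, 0, 1],
     vector [- of_real lam, - of_real c, - 1, 0], vector [- of_real c, - of_real lam, 0, 0]]"

lemma osc_matrix_mult:
  "osc_matrix lam c *v x = vector [x $ 3, x $ 4,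
     - of_real lam * x $ 1 - of_real c * x $ 2 - x $ 3, - of_real c * x $ 1 - of_real lam * x $ 2]"
  by (simp add: osc_matrix_def vec_eq_iff forall_4 matrix_vector_mult_def sum_4)

text \<open>The roots enter only through their elementary symmetric functions, so Vieta's formulas
  turn the product of shifts into the characteristic polynomial of \<open>A\<close>.\<close>

lemma fold_four_shifts:
  fixes A :: "complex^'n^'n"
  shows "fold (\<lambda>z x. A *v x - z *s x) [z1, z2, z3, z4] x =
    A *v (A *v (A *v (A *v x))) - (z1 + z2 + z3 + z4) *s (A *v (A *v (A *v x)))
    + (z1 * z2 + z1 * z3 + z1 * z4 + z2 * z3 + z2 * z4 + z3 * z4) *s (A *v (A *v x))
    - (z1 * z2 * z3 + z1 * z2 * z4 + z1 * z3 * z4 + z2 * z3 * z4) *s (A *v x)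
    + (z1 * z2 * z3 * z4) *s x"
  by (simp add: vec_eq_iff matrix_vector_mult_diff_distrib vector_scalar_commute algebra_simps)

lemma solution_Re:
  assumes "\<And>t i. ((\<lambda>t. x t $ i) has_vector_derivative (osc_matrix lam c *v x t) $ i) (at t)"
  shows "solution lam c (\<lambda>t. Re (x t $ 1)) (\<lambda>t. Re (x t $ 2)) (\<lambda>t. Re (x t $ 3)) (\<lambda>t. Re (x t $ 4))"
proof -
  have d: "((\<lambda>t. Re (x t $ i)) has_real_derivative Re ((osc_matrix lam c *v x t) $ i)) (at t within {0..})"
    for i t
    unfolding has_real_derivative_iff_has_vector_derivative
    by (rule bounded_linear.has_vector_derivative[OF bounded_linear_Re
          has_vector_derivative_at_within[OF assms]])
  show ?thesis
    unfolding solution_def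
  proof (intro allI impI)
    fix t :: real
    have "((\<lambda>t. Re (x t $ 1)) has_real_derivative Re (x t $ 3)) (at t within {0..})"
      "((\<lambda>t. Re (x t $ 2)) has_real_derivative Re (x t $ 4)) (at t within {0..})"
      "((\<lambda>t. Re (x t $ 3)) has_real_derivative
        - lam * Re (x t $ 1) - c * Re (x t $ 2) - Re (x t $ 3)) (at t within {0..})"
      "((\<lambda>t. Re (x t $ 4)) has_real_derivative
        - c * Re (x t $ 1) - lam * Re (x t $ 2)) (at t within {0..})"
      using d[where i = 1 and t = t] d[where i = 2 and t = t]
        d[where i = 3 and t = t] d[where i = 4 and t = t]
      unfolding osc_matrix_mult vector_4 by simp_all
    moreover have "- lam * Re (x t $ 1) - c * Re (x t $ 2) - Re (x t $ 3) + Re (x t $ 3)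
        + lam * Re (x t $ 1) + c * Re (x t $ 2) = 0"
      "- c * Re (x t $ 1) - lam * Re (x t $ 2) + lam * Re (x t $ 2) + c * Re (x t $ 1) = 0"
      by simp_all
    ultimately show "((\<lambda>t. Re (x t $ 1)) has_real_derivative Re (x t $ 3)) (at t within {0..}) \<and>
      ((\<lambda>t. Re (x t $ 2)) has_real_derivative Re (x t $ 4)) (at t within {0..}) \<and>
      (\<exists>u2 v2.
        ((\<lambda>t. Re (x t $ 3)) has_real_derivative u2) (at t within {0..}) \<and>
        ((\<lambda>t. Re (x t $ 4)) has_real_derivative v2) (at t within {0..}) \<and>
        u2 + Re (x t $ 3) + lam * Re (x t $ 1) + c * Re (x t $ 2) = 0 \<and>
        v2 + lam * Re (x t $ 2) + c * Re (x t $ 1) = 0)"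
      by blast
  qed
qed

lemma solution_decay:
  fixes x :: "real^4"
  assumes a: "\<And>z. char_root lam c z \<Longrightarrow> Re z < a"
  shows "\<exists>u v u1 v1 K. solution lam c u v u1 v1 \<and> vector [u 0, v 0, u1 0, v1 0] = x \<and>
    (\<forall>t\<ge>0. norm (vector [u t, v t, u1 t, v1 t] :: real^4) \<le> K * exp (a * t))"
proof -
  obtain z1 z2 z3 z4 where z: "\<forall>z. char_root lam c z \<longleftrightarrow> z \<in> {z1, z2, z3, z4}"
    and e: "z1 + z2 + z3 + z4 = - 1"
    "z1 * z2 + z1 * z3 + z1 * z4 + z2 * z3 + z2 * z4 + z3 * z4 = 2 * of_real lam"
    "z1 * z2 * z3 + z1 * z2 * z4 + z1 * z3 * z4 + z2 * z3 * z4 = - of_real lam"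
    "z1 * z2 * z3 * z4 = (of_real lam)\<^sup>2 - (of_real c)\<^sup>2"
    by (rule char_roots[of lam c])
  define x0 :: "complex^4" where "x0 = (\<chi> i. of_real (x $ i))"
  have "\<forall>z\<in>set [z1, z2, z3, z4]. Re z < a" using a z by simp
  \<comment> \<open>Cayley-Hamilton for this matrix, checked coordinatewise.\<close>
  moreover have "fold (\<lambda>z x. osc_matrix lam c *v x - z *s x) [z1, z2, z3, z4] x0 = 0"
    unfolding fold_four_shifts e
    by (simp add: osc_matrix_mult vec_eq_iff forall_4 algebra_simps power2_eq_square)
  ultimately obtain X C where X0: "X 0 = x0"
    and X: "\<forall>t i. ((\<lambda>t. X t $ i) has_vector_derivative (osc_matrix lam c *v X t) $ i) (at t)"
    and C: "\<forall>t\<ge>0. \<forall>i. norm (X t $ i) \<le> C * exp (a * t)"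
    using linear_ode_decay by blast
  have "norm (vector [Re (X t $ 1), Re (X t $ 2), Re (X t $ 3), Re (X t $ 4)] :: real^4)
      \<le> 4 * C * exp (a * t)" if "t \<ge> 0" for t
  proof -
    have "\<bar>Re (X t $ i)\<bar> \<le> C * exp (a * t)" for i
      using C that abs_Re_le_cmod order_trans by blast
    from this[of 1] this[of 2] this[of 3] this[of 4] show ?thesis
      by (intro order_trans[OF norm_le_l1_cart]) (simp add: sum_4)
  qed
  moreover have "vector [Re (X 0 $ 1), Re (X 0 $ 2), Re (X 0 $ 3), Re (X 0 $ 4)] = x"
    by (simp add: X0 x0_def vector_4_eta)
  ultimately show ?thesis
    using solution_Re[OF X[rule_format]] by blast
qed

section \<open>Growth of the operator norm and the value of the decrement\<close>

lemma char_root_Re_bounded: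
  obtains a where "\<forall>z. char_root lam c z \<longrightarrow> Re z < a"
proof -
  obtain z1 z2 z3 z4 where "\<forall>z. char_root lam c z \<longleftrightarrow> z \<in> {z1, z2, z3, z4}"
    by (rule char_roots[of lam c])
  then show thesis
    by (intro that[of "1 + \<bar>Re z1\<bar> + \<bar>Re z2\<bar> + \<bar>Re z3\<bar> + \<bar>Re z4\<bar>"]) auto
qed

lemma bounded_linear_semigroup_T:
  assumes c: "\<bar>c\<bar> < lam" and t: "t \<ge> 0"
  shows "bounded_linear (semigroup_T lam c t)"
proof -
  obtain a where "\<forall>z. char_root lam c z \<longrightarrow> Re z < a" by (rule char_root_Re_bounded[of lam c])
  note a = this[rule_format]
  have comb: "semigroup_T lam c t (\<alpha> *\<^sub>R x + \<beta> *\<^sub>R y)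
      = \<alpha> *\<^sub>R semigroup_T lam c t x + \<beta> *\<^sub>R semigroup_T lam c t y" for \<alpha> \<beta> x y
  proof -
    obtain u v u1 v1 where s: "solution lam c u v u1 v1" and x: "vector [u 0, v 0, u1 0, v1 0] = x"
      using solution_decay[OF a] by blast
    obtain u' v' u1' v1' where s': "solution lam c u' v' u1' v1'"
      and y: "vector [u' 0, v' 0, u1' 0, v1' 0] = y"
      using solution_decay[OF a] by blast
    have "\<alpha> *\<^sub>R vector [p, q, r, s] + \<beta> *\<^sub>R vector [p', q', r', s'] =
        (vector [\<alpha> * p + \<beta> * p', \<alpha> * q + \<beta> * q', \<alpha> * r + \<beta> * r', \<alpha> * s + \<beta> * s'] :: real^4)"
      for p q r s p' q' r' s'
      by (simp add: vec_eq_iff forall_4)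
    then show ?thesis
      using semigroup_T_eqI[OF solution_linear_combination[OF s s'] c t, of \<alpha> \<beta>]
        semigroup_T_eqI[OF s c t] semigroup_T_eqI[OF s' c t]
      by (simp flip: x y)
  qed
  show ?thesis
    \<comment> \<open>Coefficients \<open>1, 1\<close> give additivity, a zero second coefficient
      gives homogeneity; boundedness is automatic in finite dimension.\<close>
    using comb[of 1 _ 1] comb[of _ _ 0] by (intro bounded_linearI') simp_all
qed

text \<open>The bound for single trajectories has a constant depending on the initial vector.
  Expanding in the standard basis leaves finitely many constants, whose sum is uniform.\<close>

lemma onorm_semigroup_T_le:
  assumes c: "\<bar>c\<bar> < lam" and a: "\<And>z. char_root lam c z \<Longrightarrow> Re z < a"
  obtains K where "\<And>t. t \<ge> 0 \<Longrightarrow> onorm (semigroup_T lam c t) \<le> K * exp (a * t)"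
proof -
  have "\<exists>K. \<forall>t\<ge>0. norm (semigroup_T lam c t x) \<le> K * exp (a * t)" for x
  proof -
    obtain u v u1 v1 K where s: "solution lam c u v u1 v1" and x: "vector [u 0, v 0, u1 0, v1 0] = x"
      and K: "\<forall>t\<ge>0. norm (vector [u t, v t, u1 t, v1 t] :: real^4) \<le> K * exp (a * t)"
      using solution_decay[OF a] by blast
    show ?thesis
      using K semigroup_T_eqI[OF s c] unfolding x by (intro exI[of _ K]) simp
  qed
  then obtain k where k: "\<And>x t. t \<ge> 0 \<Longrightarrow> norm (semigroup_T lam c t x) \<le> k x * exp (a * t)"
    by metis
  have "onorm (semigroup_T lam c t) \<le> sum k Basis * exp (a * t)" if t: "t \<ge> 0" for t
  proof (rule onorm_le)
    fix x :: "real^4"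
    interpret T: bounded_linear "semigroup_T lam c t"
      using c t by (rule bounded_linear_semigroup_T)
    have "norm (semigroup_T lam c t x) = norm (\<Sum>i\<in>Basis. (x \<bullet> i) *\<^sub>R semigroup_T lam c t i)"
      by (subst euclidean_representation[of x, symmetric]) (simp only: T.sum T.scaleR)
    also have "\<dots> \<le> (\<Sum>i\<in>Basis. norm x * (k i * exp (a * t)))"
      by (intro sum_norm_le) (auto intro!: mult_mono k[OF t] Basis_le_norm)
    finally show "norm (semigroup_T lam c t x) \<le> sum k Basis * exp (a * t) * norm x"
      by (simp add: sum_distrib_left sum_distrib_right mult_ac)
  qed
  then show thesis by (rule that)
qed

text \<open>The eigenvector solution for \<open>z\<close> has size at least
  \<open>\<bar>c\<bar> * exp (Re z * t)\<close>, so a weight \<open>exp (g * t)\<close> with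
  \<open>g > - Re z\<close> makes it unbounded.\<close>

lemma decay_rate_le:
  assumes c: "c \<noteq> 0" "\<bar>c\<bar> < lam" and z: "char_root lam c z"
    and bdd: "bounded ((\<lambda>t. exp (g * t) * onorm (semigroup_T lam c t)) ` {0..})"
  shows "g \<le> - Re z"
proof (rule ccontr)
  define r where "r = g + Re z"
  assume "\<not> g \<le> - Re z"
  then have r: "r > 0" by (simp add: r_def)
  \<comment> \<open>Positions \<open>(z\<^sup>2 + lam, -c)\<close> satisfy the second equation
    identically and the first by the characteristic equation; velocities are \<open>z\<close> times
    positions. The second entry is nonzero as \<open>c \<noteq> 0\<close>.\<close>
  define V :: "complex^4" where
    "V = vector [z\<^sup>2 + of_real lam, - of_real c, z * (z\<^sup>2 + of_real lam), - z * of_real c]"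
  have V: "osc_matrix lam c *v V = z *s V"
  proof -
    have "- of_real lam * (z\<^sup>2 + of_real lam) + of_real c * of_real c - z * (z\<^sup>2 + of_real lam)
        = z * (z * (z\<^sup>2 + of_real lam))"
      using z unfolding char_root_def by algebra
    then show ?thesis
      by (simp add: osc_matrix_mult V_def vec_eq_iff forall_4 algebra_simps power2_eq_square)
  qed
  \<comment> \<open>The factor \<open>w\<close> recovers both real parts: \<open>w = 1\<close> gives
    the real part of the eigenvector solution, \<open>w = - \<i>\<close> its imaginary part.\<close>
  define X where "X w t = (w * exp (z * of_real t)) *s V" for w :: complex and t :: real
  have "((\<lambda>t. X w t $ i) has_vector_derivative (osc_matrix lam c *v X w t) $ i) (at t)" for w t i
  proof -
    have "((\<lambda>t. w * exp (z * of_real t) * V $ i) has_vector_derivative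
        w * (z * exp (z * of_real t)) * V $ i) (at t)"
      by (intro has_vector_derivative_mult_left has_vector_derivative_mult_right
          has_vector_derivative_exp_of_real)
    then show ?thesis
      by (simp add: X_def vector_scalar_commute V mult_ac)
  qed
  note sol = solution_Re[OF this]
  define Y :: "complex \<Rightarrow> real \<Rightarrow> real^4" where
    "Y w t = vector [Re (X w t $ 1), Re (X w t $ 2), Re (X w t $ 3), Re (X w t $ 4)]" for w t
  have T: "semigroup_T lam c t (Y w 0) = Y w t" if "t \<ge> 0" for w t
    unfolding Y_def by (rule semigroup_T_eqI[OF sol c(2) that])
  from bdd obtain M where M: "\<And>t. t \<ge> 0 \<Longrightarrow> \<bar>exp (g * t) * onorm (semigroup_T lam c t)\<bar> \<le> M"
    unfolding bounded_iff by auto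
  define N where "N = norm (Y 1 0) + norm (Y (- \<i>) 0)"
  have key: "\<bar>c\<bar> * (1 + r * t) \<le> M * N" if t: "t \<ge> 0" for t
  proof -
    have Yb: "exp (g * t) * norm (Y w t) \<le> M * norm (Y w 0)" for w
    proof -
      have "exp (g * t) * norm (Y w t)
          \<le> exp (g * t) * (onorm (semigroup_T lam c t) * norm (Y w 0))"
        using onorm[OF bounded_linear_semigroup_T[OF c(2) t], of "Y w 0"] T[OF t]
        by (intro mult_left_mono) auto
      also have "\<dots> \<le> M * norm (Y w 0)"
        using M[OF t] by (auto simp: mult.assoc[symmetric] intro!: mult_right_mono)
      finally show ?thesis .
    qed
    have "\<bar>c\<bar> * exp (Re z * t) = norm (of_real c * exp (z * of_real t))"
      by (simp add: norm_mult)
    also have "\<dots> \<le> \<bar>Re (of_real c * exp (z * of_real t))\<bar> + \<bar>Im (of_real c * exp (z * of_real t))\<bar>"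
      by (rule cmod_le)
    also have "\<dots> = \<bar>Y 1 t $ 2\<bar> + \<bar>Y (- \<i>) t $ 2\<bar>"
      by (simp add: Y_def X_def V_def mult.commute)
    also have "\<dots> \<le> norm (Y 1 t) + norm (Y (- \<i>) t)"
      by (intro add_mono component_le_norm_cart)
    finally have "exp (g * t) * (\<bar>c\<bar> * exp (Re z * t)) \<le> exp (g * t) * (norm (Y 1 t) + norm (Y (- \<i>) t))"
      by (intro mult_left_mono) auto
    also have "\<dots> \<le> M * N"
      using Yb[of 1] Yb[of "- \<i>"] by (simp add: N_def distrib_left)
    finally have "\<bar>c\<bar> * exp (r * t) \<le> M * N"
      by (simp add: r_def distrib_right exp_add mult.left_commute)
    moreover have "\<bar>c\<bar> * (1 + r * t) \<le> \<bar>c\<bar> * exp (r * t)"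
      by (intro mult_left_mono exp_ge_add_one_self) auto
    ultimately show ?thesis by linarith
  qed
  have MN: "M * N \<ge> \<bar>c\<bar>" using key[of 0] by simp
  \<comment> \<open>This time makes the linear term \<open>\<bar>c\<bar> * r * t\<close> equal to
    the supposed bound \<open>M * N\<close>.\<close>
  have "\<bar>c\<bar> * (1 + r * (M * N / (\<bar>c\<bar> * r))) \<le> M * N"
    by (rule key) (use MN r c in auto)
  then have "\<bar>c\<bar> + M * N \<le> M * N"
    using r c by (simp add: distrib_left)
  with c show False by simp
qed

text \<open>Every \<open>g\<close> strictly between \<open>0\<close> and \<open>b\<close> is
  admissible, since all roots then have real part below \<open>- g\<close>, and none above
  \<open>b\<close> is. Whether \<open>b\<close> itself is admissible does not affect the
  supremum.\<close>

lemma log_decrement_eq: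
  assumes c: "c \<noteq> 0" "\<bar>c\<bar> < lam" and b: "b > 0"
    and z: "char_root lam c z" "Re z = - b"
    and max: "\<And>w. char_root lam c w \<Longrightarrow> Re w \<le> - b"
  shows "log_decrement lam c = b"
proof -
  define S where "S = {g. g > 0 \<and> bounded ((\<lambda>t. exp (g * t) * onorm (semigroup_T lam c t)) ` {0..})}"
  have upper: "g \<le> b" if "g \<in> S" for g
    using decay_rate_le[OF c z(1), of g] that z(2) by (simp add: S_def)
  have lower: "g \<in> S" if g: "0 < g" "g < b" for g
  proof -
    have "Re w < - g" if "char_root lam c w" for w
      using max[OF that] g by simp
    then obtain K where K: "\<And>t. t \<ge> 0 \<Longrightarrow> onorm (semigroup_T lam c t) \<le> K * exp (- g * t)"
      using onorm_semigroup_T_le[OF c(2)] by blast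
    have "norm (exp (g * t) * onorm (semigroup_T lam c t)) \<le> K" if t: "t \<ge> 0" for t
    proof -
      have "exp (g * t) * onorm (semigroup_T lam c t) \<le> exp (g * t) * (K * exp (- g * t))"
        using K[OF t] by (intro mult_left_mono) auto
      also have "\<dots> = K" by (simp add: exp_minus)
      finally show ?thesis
        using onorm_pos_le[OF bounded_linear_semigroup_T[OF c(2) t]] by simp
    qed
    then show ?thesis using g by (auto simp: S_def bounded_iff)
  qed
  have "Sup S = b"
  proof (rule antisym)
    show "Sup S \<le> b"
      using lower[of "b / 2"] b upper by (intro cSup_least) auto
    show "b \<le> Sup S"
    proof (rule dense_le_bounded[OF b])
      fix g assume "0 < g" "g < b"
      then show "g \<le> Sup S"
        using lower upper by (intro cSup_upper) (auto intro: bdd_aboveI[of S b])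
    qed
  qed
  then show ?thesis by (simp add: log_decrement_def S_def)
qed

section \<open>Location of the characteristic roots and the two claims\<close>

text \<open>
  Pairing the eigenvector equation with the eigenvector \<open>(z\<^sup>2 + lam, -c)\<close> itself gives a real
  quadratic equation for \<open>z\<close> with positive coefficients.
\<close>

lemma char_root_Re_neg:
  assumes c: "c \<noteq> 0" "\<bar>c\<bar> < lam" and z: "char_root lam c z"
  shows "Re z < 0"
proof -
  define u where "u = z\<^sup>2 + of_real lam"
  define p where "p = (cmod u)\<^sup>2"
  \<comment> \<open>The potential energy form, extended to complex vectors, at the eigenvector
    \<open>(u, -c)\<close>. As \<open>p \<ge> (Re u)\<^sup>2\<close>, it is bounded below by the
    real form at \<open>(Re u, -c)\<close>.\<close>
  define q where "q = lam * p + lam * c\<^sup>2 - 2 * c\<^sup>2 * Re u"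
  have eq: "(u + z) * u = (of_real c)\<^sup>2"
    using z by (simp add: char_root_def u_def algebra_simps)
  then have "u \<noteq> 0" using c by auto
  then have p: "p > 0" by (simp add: p_def)
  have q: "q > 0"
  proof (rule ccontr)
    assume "\<not> q > 0"
    have "(Re u)\<^sup>2 \<le> p" by (simp add: p_def cmod_power2)
    then have "lam * (Re u)\<^sup>2 \<le> lam * p" using c by (intro mult_left_mono) auto
    with \<open>\<not> q > 0\<close> have "lam * (Re u)\<^sup>2 + lam * (- c)\<^sup>2 + 2 * c * Re u * (- c) \<le> 0"
      by (simp add: q_def power2_eq_square algebra_simps)
    from energy_coercive(2)[OF c(2) this] c show False by simp
  qed
  have "of_real (p + c\<^sup>2) * z\<^sup>2 + of_real p * z + of_real q = 0"
  proof -
    have n: "of_real p = u * cnj u" unfolding p_def complex_norm_square[symmetric] by simp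
    have re: "2 * of_real (Re u) = u + cnj u" by (simp add: complex_add_cnj)
    have "of_real (p + c\<^sup>2) * z\<^sup>2 + of_real p * z + of_real q
        = of_real p * (z\<^sup>2 + of_real lam + z) + of_real c ^ 2 * (z\<^sup>2 + of_real lam)
          - of_real c ^ 2 * (2 * of_real (Re u))"
      by (simp add: q_def algebra_simps)
    also have "\<dots> = cnj u * ((u + z) * u - of_real c ^ 2)"
      unfolding n re u_def[symmetric] by (simp add: algebra_simps)
    finally show ?thesis using eq by simp
  qed
  then have re: "(p + c\<^sup>2) * ((Re z)\<^sup>2 - (Im z)\<^sup>2) + p * Re z + q = 0"
    and im: "Im z * (2 * (p + c\<^sup>2) * Re z + p) = 0"
    by (auto simp: complex_eq_iff algebra_simps power2_eq_square)
  show ?thesis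
  proof (rule ccontr)
    assume "\<not> Re z < 0"
    then have z0: "Re z \<ge> 0" by simp
    \<comment> \<open>A nonnegative real part forces \<open>z\<close> to be real; the quadratic with
      positive coefficients then has no such root.\<close>
    then have "2 * (p + c\<^sup>2) * Re z + p > 0"
      using p by (intro add_nonneg_pos mult_nonneg_nonneg) auto
    with im have "Im z = 0" by simp
    with re have "(p + c\<^sup>2) * (Re z)\<^sup>2 + p * Re z + q = 0" by simp
    moreover have "(p + c\<^sup>2) * (Re z)\<^sup>2 \<ge> 0" "p * Re z \<ge> 0" using p z0 by auto
    ultimately show False using q by linarith
  qed
qed

text \<open>
  The shifted roots \<open>z + 1/4\<close> have sum \<open>0\<close>, so if none has positive real part, all are imaginary;
  but then their third elementary symmetric function would be imaginary, whereas it equals \<open>-1/8\<close>.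
\<close>

lemma char_root_Re_gt:
  obtains z where "char_root lam c z" "Re z > - 1 / 4"
proof -
  obtain z1 z2 z3 z4 where z: "\<forall>z. char_root lam c z \<longleftrightarrow> z \<in> {z1, z2, z3, z4}"
    and e: "z1 + z2 + z3 + z4 = - 1"
    "z1 * z2 + z1 * z3 + z1 * z4 + z2 * z3 + z2 * z4 + z3 * z4 = 2 * of_real lam"
    "z1 * z2 * z3 + z1 * z2 * z4 + z1 * z3 * z4 + z2 * z3 * z4 = - of_real lam"
    by (rule char_roots[of lam c])
  \<comment> \<open>Scaling the shifted roots by \<open>4\<close> clears denominators; the third
    symmetric function \<open>-1/8\<close> becomes \<open>-8\<close>.\<close>
  define w1 w2 w3 w4 where "w1 = 4 * z1 + 1" "w2 = 4 * z2 + 1" "w3 = 4 * z3 + 1" "w4 = 4 * z4 + 1"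
  note w = this
  have "w1 * w2 * w3 + w1 * w2 * w4 + w1 * w3 * w4 + w2 * w3 * w4 = - 8"
  proof -
    have "w1 * w2 * w3 + w1 * w2 * w4 + w1 * w3 * w4 + w2 * w3 * w4
       = 64 * (z1 * z2 * z3 + z1 * z2 * z4 + z1 * z3 * z4 + z2 * z3 * z4)
         + 32 * (z1 * z2 + z1 * z3 + z1 * z4 + z2 * z3 + z2 * z4 + z3 * z4)
         + 12 * (z1 + z2 + z3 + z4) + 4"
      unfolding w by algebra
    then show ?thesis unfolding e by simp
  qed
  then have e3: "Re (w1 * w2 * w3 + w1 * w2 * w4 + w1 * w3 * w4 + w2 * w3 * w4) = - 8"
    by simp
  have sum: "Re w1 + Re w2 + Re w3 + Re w4 = 0"
    using arg_cong[OF e(1), of Re] by (simp add: w)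
  have "\<not> (Re w1 \<le> 0 \<and> Re w2 \<le> 0 \<and> Re w3 \<le> 0 \<and> Re w4 \<le> 0)"
  proof
    assume "Re w1 \<le> 0 \<and> Re w2 \<le> 0 \<and> Re w3 \<le> 0 \<and> Re w4 \<le> 0"
    with sum have "Re w1 = 0" "Re w2 = 0" "Re w3 = 0" "Re w4 = 0" by linarith+
    then show False using e3 by simp
  qed
  then have "\<exists>v\<in>{z1, z2, z3, z4}. Re v > - 1 / 4"
    by (auto simp: w)
  with z that show thesis by blast
qed

lemma log_decrement_less:
  assumes c: "c \<noteq> 0" "\<bar>c\<bar> < lam"
  shows "log_decrement lam c < 1 / 4"
proof -
  obtain z1 z2 z3 z4 where z: "\<forall>z. char_root lam c z \<longleftrightarrow> z \<in> {z1, z2, z3, z4}"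
    by (rule char_roots[of lam c])
  have "Max (Re ` {z1, z2, z3, z4}) \<in> Re ` {z1, z2, z3, z4}"
    by (intro Max_in) auto
  then obtain z0 where "z0 \<in> {z1, z2, z3, z4}" "Re z0 = Max (Re ` {z1, z2, z3, z4})"
    by (metis imageE)
  moreover have "Re w \<le> Max (Re ` {z1, z2, z3, z4})" if "w \<in> {z1, z2, z3, z4}" for w
    using that by (intro Max_ge) auto
  ultimately have z0: "char_root lam c z0" "\<And>w. char_root lam c w \<Longrightarrow> Re w \<le> Re z0"
    using z by metis+
  have "log_decrement lam c = - Re z0"
    using char_root_Re_neg[OF c z0(1)] z0 by (intro log_decrement_eq[OF c]) auto
  moreover obtain w where "char_root lam c w" "Re w > - 1 / 4"
    by (rule char_root_Re_gt[of lam c])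
  ultimately show ?thesis using z0(2)[of w] by simp
qed

text \<open>
  For the parameters below the characteristic polynomial at \<open>z = w - 1/4\<close> is
  \<open>(w\<^sup>2 - 2 eps w + d) (w\<^sup>2 + 2 eps w)\<close> with \<open>d = 1 / (16 eps)\<close>; the roots of the first factor have
  real part \<open>eps\<close>, the others are \<open>0\<close> and \<open>-2 eps\<close>.
\<close>

lemma log_decrement_attained:
  assumes eps: "0 < eps" "eps < 1 / 4"
  shows "\<exists>lam c. lam > 0 \<and> 0 < c \<and> c < lam \<and> log_decrement lam c = 1 / 4 - eps"
proof -
  \<comment> \<open>At \<open>z = w - 1/4\<close> the polynomial is \<open>w^4 + (2 lam - 3/8) w^2 +
    w/8 + (lam + 1/16) (lam - 3/16) - c^2\<close>. Matching the linear, quadratic and constant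
    coefficients with the factorisation determines \<open>d\<close>, \<open>lam\<close> and
    \<open>c\<close> in turn.\<close>
  define d where "d = 1 / (16 * eps)"
  define lam where "lam = d / 2 - 2 * eps\<^sup>2 + 3 / 16"
  define c where "c = sqrt ((lam + 1 / 16) * (lam - 3 / 16))"
  have epsd: "16 * eps * d = 1" using eps by (simp add: d_def)
  have sq: "16 * eps\<^sup>2 < 1"
    using power_strict_mono[OF eps(2), of 2] eps by (simp add: power2_eq_square)
  \<comment> \<open>With \<open>eps\<^sup>2 < 1/16\<close> this gives \<open>lam > 3/16\<close>, so
    \<open>c\<close> is the root of a positive number, and \<open>d > eps\<^sup>2\<close>, so the
    first factor has non-real roots.\<close>
  have d: "d > 1 / 4" using eps by (simp add: d_def field_simps)
  have lam: "lam > 3 / 16" using d sq by (simp add: lam_def)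
  have c2: "c\<^sup>2 = (lam + 1 / 16) * (lam - 3 / 16)" using lam by (simp add: c_def)
  have c0: "c > 0" using lam by (simp add: c_def)
  have "c\<^sup>2 < lam\<^sup>2" unfolding c2 using lam by (simp add: algebra_simps power2_eq_square)
  then have clam: "c < lam" by (rule power2_less_imp_less) (use lam in simp)
  have root: "char_root lam c (w - 1 / 4) \<longleftrightarrow>
      w\<^sup>2 - 2 * of_real eps * w + of_real d = 0 \<or> w * (w + 2 * of_real eps) = 0" for w
  proof -
    have "(of_real c :: complex)\<^sup>2 = (of_real lam + 1 / 16) * (of_real lam - 3 / 16)"
      using arg_cong[OF c2, of complex_of_real] by simp
    moreover have "complex_of_real lam = of_real d / 2 - 2 * (of_real eps)\<^sup>2 + 3 / 16"
      by (simp add: lam_def)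
    moreover have "16 * complex_of_real eps * of_real d = 1"
      using arg_cong[OF epsd, of complex_of_real] by simp
    ultimately have "((w - 1 / 4)\<^sup>2 + (w - 1 / 4) + of_real lam) * ((w - 1 / 4)\<^sup>2 + of_real lam)
        - (of_real c)\<^sup>2 = (w\<^sup>2 - 2 * of_real eps * w + of_real d) * (w * (w + 2 * of_real eps))"
      by algebra
    then show ?thesis
      unfolding char_root_def by (subst right_minus_eq[symmetric]) simp
  qed
  have "log_decrement lam c = 1 / 4 - eps"
  proof (rule log_decrement_eq)
    show "c \<noteq> 0" "\<bar>c\<bar> < lam" "1 / 4 - eps > 0" using c0 clam eps by auto
    show "char_root lam c (Complex eps (sqrt (d - eps\<^sup>2)) - 1 / 4)"
      unfolding root using d sq by (simp add: complex_eq_iff power2_eq_square algebra_simps)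
    show "Re (Complex eps (sqrt (d - eps\<^sup>2)) - 1 / 4) = - (1 / 4 - eps)" by simp
    fix v assume "char_root lam c v"
    with root[of "v + 1 / 4"] have "v = - 1 / 4 \<or> v + 1 / 4 = - 2 * of_real eps \<or>
        (v + 1 / 4)\<^sup>2 - 2 * of_real eps * (v + 1 / 4) + of_real d = 0"
      by (auto simp: add_eq_0_iff2)
    then show "Re v \<le> - (1 / 4 - eps)"
    proof (elim disjE)
      assume q: "(v + 1 / 4)\<^sup>2 - 2 * of_real eps * (v + 1 / 4) + of_real d = 0"
      define x y where "x = Re v + 1 / 4" "y = Im v"
      note xy = this
      have re: "x\<^sup>2 - y\<^sup>2 - 2 * eps * x + d = 0" and im: "y * (x - eps) = 0"
        using arg_cong[OF q, of Re] arg_cong[OF q, of Im]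
        by (simp_all add: xy power2_eq_square algebra_simps)
      \<comment> \<open>A real root would contradict the negative discriminant; the imaginary part
        of the equation then forces \<open>x = eps\<close>.\<close>
      have "y \<noteq> 0"
      proof
        assume "y = 0"
        with re have "(x - eps)\<^sup>2 = eps\<^sup>2 - d" by (simp add: power2_eq_square algebra_simps)
        with d sq zero_le_power2[of "x - eps"] show False by linarith
      qed
      with im show ?thesis by (simp add: xy)
    next
      assume "v = - 1 / 4" then show ?thesis using eps by simp
    next
      assume "v + 1 / 4 = - 2 * of_real eps"
      from arg_cong[OF this, of Re] show ?thesis using eps by simp
    qed
  qed
  moreover have "lam > 0" using lam by simp
  ultimately show ?thesis using c0 clam by blast
qed

theorem proposition3p4:
  shows "(\<forall>lam c::real. 0 < \<bar>c\<bar> \<and> \<bar>c\<bar> < lam \<longrightarrow> log_decrement lam c < 1/4) \<and>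
    (\<exists>eps0>0::real. \<forall>eps. 0 < eps \<and> eps < eps0 \<longrightarrow>
       (\<exists>lam c. lam > 0 \<and> 0 < c \<and> c < lam \<and> log_decrement lam c = 1/4 - eps))"
proof (intro conjI)
  show "\<forall>lam c::real. 0 < \<bar>c\<bar> \<and> \<bar>c\<bar> < lam \<longrightarrow> log_decrement lam c < 1/4"
    using log_decrement_less by simp
  show "\<exists>eps0>0::real. \<forall>eps. 0 < eps \<and> eps < eps0 \<longrightarrow>
       (\<exists>lam c. lam > 0 \<and> 0 < c \<and> c < lam \<and> log_decrement lam c = 1/4 - eps)"
    using log_decrement_attained by (intro exI[of _ "1 / 4"]) auto
qed

end
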